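(* Let $G$ be a finite simple graph. For each vertex $v \in V(G)$ let $p(v)$ denote the maximum number $r$ such that $v$ lies on a path of $G$ with $r$ edges. Then \[ |E(G)| \le \sum_{v \in V(G)} \frac{p(v)}{2}, \] and equality holds if and only if every connected component of $G$ is a clique (complete graph).
   Context: A path with $r$ edges (length $r$) is a sequence of $r+1$ distinct vertices with consecutive ones adjacent; a single vertex is a path with $0$ edges, so an isolated vertex $v$ has $p(v)=0$. *)

theory Defs
  imports Complex_Main "Graph_Theory.Graph_Theory"
begin

text \<open>
  The locale \<^locale>\<open>graph\<close> models a finite simple graph as a finite, loop-free, symmetric
  digraph without parallel arcs (the null graph is allowed). An undirected edge is therefore a
  pair of opposite arcs, and is counted once by passing to the set of its two ends.
\<close>

definition edges :: "('a, 'b) pre_digraph \<Rightarrow> 'a set set" where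
  "edges G = (\<lambda>a. {tail G a, head G a}) ` arcs G"

text \<open>
  A \<^const>\<open>vpath\<close> is a nonempty list of distinct vertices, consecutive ones adjacent, and
  \<^const>\<open>vwalk_length\<close> is its number of edges; a one-element list is a path of length 0. The
  vertex \<open>v\<close> may occur anywhere on the path.
\<close>

definition path_number :: "('a, 'b) pre_digraph \<Rightarrow> 'a \<Rightarrow> nat" where
  "path_number G v = Max {vwalk_length xs | xs. vpath xs G \<and> v \<in> set xs}"

text \<open>
  The name \<open>connected\<close> is qualified because HOL also has topological connectedness. A
  connected graph has at least one vertex.
\<close>

definition components :: "('a, 'b) pre_digraph \<Rightarrow> ('a, 'b) pre_digraph set" where
  "components G = {C. pre_digraph.max_subgraph G Digraph_Component.connected C}"

definition is_clique :: "('a, 'b) pre_digraph \<Rightarrow> bool" where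
  "is_clique G \<longleftrightarrow> (\<exists>n. complete_digraph n G)"

text \<open>The maximum defining \<^const>\<open>path_number\<close> is over a finite nonempty set.\<close>

lemma finite_path_lengths:
  assumes "graph G"
  shows "finite {vwalk_length xs | xs. vpath xs G \<and> v \<in> set xs}"
proof (rule finite_subset)
  interpret graph G by fact
  have "length xs \<le> card (verts G)" if "vpath xs G" for xs
  proof -
    have "card (set xs) \<le> card (verts G)"
      using that by (intro card_mono) (auto simp: vpath_def vwalk_def)
    then show ?thesis using that by (simp add: vpath_def distinct_card)
  qed
  then show "{vwalk_length xs | xs. vpath xs G \<and> v \<in> set xs} \<subseteq> {..card (verts G)}"
    by (auto intro: le_trans[OF diff_le_self])
qed simp

lemma path_lengths_nonempty:
  assumes "v \<in> verts G"
  shows "0 \<in> {vwalk_length xs | xs. vpath xs G \<and> v \<in> set xs}"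
  using assms by (auto intro!: exI[of _ "[v]"] simp: vpath_def vwalk_def)

end

theory Submission
  imports Defs
begin

text \<open>
  Induction on the vertex set. Take a longest path, with \<open>k\<close> edges, so that every vertex on it
  has path number \<open>k\<close>. If some vertex on it has degree at most \<open>k / 2\<close>, delete that vertex.
  Otherwise the degrees of the two ends sum to more than \<open>k\<close>, so the path closes up to a
  cycle on the same vertices; by maximality these form a component with \<open>k + 1\<close> vertices,
  hence at most \<open>k (k + 1) / 2\<close> edges, and this component is deleted.
  In the case of equality, a component deleted as a whole is a clique, and a vertex \<open>v\<close> deleted
  alone is isolated: all other path numbers are unaffected by deleting \<open>v\<close>, whereas a
  neighbour of \<open>v\<close> lies in a clique that \<open>v\<close> would extend to a longer path.
\<close>

section \<open>Degrees and path numbers of a symmetric irreflexive relation\<close>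

locale simple_adjacency =
  fixes R :: "'a \<Rightarrow> 'a \<Rightarrow> bool"
  assumes sym: "R x y \<Longrightarrow> R y x"
    and irrefl: "\<not> R x x"
begin

text \<open>The relation stays fixed and the vertex set is a parameter, so deleting vertices only
  shrinks \<open>S\<close>.\<close>

definition deg :: "'a set \<Rightarrow> 'a \<Rightarrow> nat" where
  "deg S v = card {u \<in> S. R v u}"

definition path_in :: "'a set \<Rightarrow> 'a list \<Rightarrow> bool" where
  "path_in S xs \<longleftrightarrow> xs \<noteq> [] \<and> distinct xs \<and> set xs \<subseteq> S \<and> successively R xs"

definition path_num :: "'a set \<Rightarrow> 'a \<Rightarrow> nat" where
  "path_num S v = Max {length xs - 1 | xs. path_in S xs \<and> v \<in> set xs}"

text \<open>Disjoint unions of cliques, expressed as the absence of an induced path on three vertices.\<close>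

definition cluster :: "'a set \<Rightarrow> bool" where
  "cluster S \<longleftrightarrow> (\<forall>x\<in>S. \<forall>y\<in>S. \<forall>z\<in>S. R x y \<longrightarrow> R y z \<longrightarrow> x = z \<or> R x z)"

lemma length_path_in: "finite S \<Longrightarrow> path_in S xs \<Longrightarrow> length xs \<le> card S"
  by (metis card_mono distinct_card path_in_def)

lemma path_in_mono: "path_in S xs \<Longrightarrow> S \<subseteq> T \<Longrightarrow> path_in T xs"
  by (auto simp: path_in_def)

lemma successively_rev_iff: "successively R (rev xs) \<longleftrightarrow> successively R xs"
  unfolding successively_rev by (intro iffI; erule successively_mono; erule sym)

lemma path_in_rev: "path_in S xs \<Longrightarrow> path_in S (rev xs)"
  by (simp add: path_in_def successively_rev_iff del: successively_rev)

lemma path_in_singleton: "path_in S [v] \<longleftrightarrow> v \<in> S"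
  by (auto simp: path_in_def)

lemma path_in_Cons: "path_in S xs \<Longrightarrow> v \<in> S \<Longrightarrow> v \<notin> set xs \<Longrightarrow> R v (hd xs) \<Longrightarrow> path_in S (v # xs)"
  by (auto simp: path_in_def successively_Cons)

lemma finite_path_in_lengths:
  assumes "finite S"
  shows "finite {length xs - 1 | xs. path_in S xs \<and> v \<in> set xs}"
proof (rule finite_subset)
  show "{length xs - 1 | xs. path_in S xs \<and> v \<in> set xs} \<subseteq> {..card S}"
    using length_path_in[OF assms] by (auto intro: le_trans[OF diff_le_self])
qed simp

lemma path_num_ge:
  "finite S \<Longrightarrow> path_in S xs \<Longrightarrow> v \<in> set xs \<Longrightarrow> length xs - 1 \<le> path_num S v"
  unfolding path_num_def by (rule Max_ge[OF finite_path_in_lengths]) auto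

lemma path_num_attained:
  assumes "finite S" "v \<in> S"
  obtains xs where "path_in S xs" "v \<in> set xs" "path_num S v = length xs - 1"
proof -
  have "path_num S v \<in> {length xs - 1 | xs. path_in S xs \<and> v \<in> set xs}"
    unfolding path_num_def using assms path_in_singleton[of S v]
    by (intro Max_in finite_path_in_lengths) (auto intro!: exI[of _ "[v]"])
  with that show thesis by auto
qed

lemma path_num_mono:
  assumes "finite T" "S \<subseteq> T" "v \<in> S"
  shows "path_num S v \<le> path_num T v"
proof -
  obtain xs where "path_in S xs" "v \<in> set xs" "path_num S v = length xs - 1"
    using path_num_attained[of S v] assms finite_subset by blast
  then show ?thesis using path_num_ge[of T xs v] assms by (auto dest: path_in_mono)
qed

section \<open>Path numbers in disjoint unions of cliques\<close>

text \<open>Any two vertices of a path in a disjoint union of cliques are equal or adjacent, so the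
  rest of a path through \<open>v\<close> consists of neighbours of \<open>v\<close>.\<close>

lemma path_num_le_deg:
  assumes "finite S" "cluster S" "v \<in> S"
  shows "path_num S v \<le> deg S v"
proof -
  obtain xs where xs: "path_in S xs" "v \<in> set xs" "path_num S v = length xs - 1"
    using path_num_attained assms by blast
  have "x = y \<or> R x y" if "path_in S ys" "x \<in> set ys" "y \<in> set ys" for ys x y
    using that
  proof (induction ys arbitrary: x y)
    case (Cons a ys)
    show ?case
    proof (cases "ys = []")
      case False
      with Cons.prems have ys: "path_in S ys" "R a (hd ys)" "hd ys \<in> set ys" "a \<in> S" "set ys \<subseteq> S"
        by (auto simp: path_in_def successively_Cons)
      \<comment> \<open>\<open>a\<close> is adjacent to the next vertex \<open>hd ys\<close>, which
        equals \<open>b\<close> or is adjacent to it; the cluster property carries the adjacency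
        over to \<open>a\<close>.\<close>
      have "R a b" if "b \<in> set ys" for b
      proof (cases "hd ys = b")
        case False
        then have "R (hd ys) b" using Cons.IH[OF ys(1) ys(3) that] by simp
        moreover have "a \<noteq> b" using Cons.prems(1) that by (auto simp: path_in_def)
        ultimately show ?thesis
          using assms(2) ys that unfolding cluster_def by blast
      qed (use ys in simp)
      then show ?thesis using Cons.IH[OF ys(1)] Cons.prems(2,3) sym by auto
    qed (use Cons.prems in auto)
  qed (simp add: path_in_def)
  then have "set xs - {v} \<subseteq> {u \<in> S. R v u}"
    using xs by (auto simp: path_in_def)
  then have "card (set xs - {v}) \<le> deg S v"
    unfolding deg_def using assms(1) by (intro card_mono) auto
  then show ?thesis using xs by (simp add: path_in_def distinct_card)
qed

text \<open>In \<open>S - {v}\<close>, the vertex \<open>u\<close> and its neighbours form a clique.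
  A path starting with \<open>v\<close> and \<open>u\<close> can run through all these neighbours,
  which gives one edge more than \<open>deg (S - {v}) u\<close>, a bound on the old path
  number.\<close>

lemma path_num_less_of_neighbour:
  assumes fin: "finite S" and cl: "cluster (S - {v})"
    and "v \<in> S" "u \<in> S" "R v u"
  shows "path_num (S - {v}) u < path_num S u"
proof -
  let ?T = "S - {v}"
  have "u \<noteq> v" using assms irrefl by auto
  then have u: "u \<in> ?T" using assms by auto
  have "finite {w \<in> ?T. R u w}" using fin by auto
  then obtain zs where zs: "set zs = {w \<in> ?T. R u w}" "distinct zs"
    using finite_distinct_list by metis
  \<comment> \<open>\<open>x\<close> and \<open>y\<close> share the neighbour \<open>u\<close>, so
    they are adjacent, and the neighbours may be listed in any order.\<close>
  have "R x y" if "x \<in> set zs" "y \<in> set zs" "x \<noteq> y" for x y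
    using cl that zs(1) u sym[of u x] unfolding cluster_def by blast
  then have "successively R zs"
    using zs(2) unfolding successively_conv_nth
    by (metis Suc_lessD n_not_Suc_n nth_eq_iff_index_eq nth_mem)
  then have "successively R (u # zs)"
    using zs(1) by (cases zs) auto
  then have "path_in S (v # u # zs)"
    using assms u zs by (auto simp: path_in_def irrefl)
  then have "length (v # u # zs) - 1 \<le> path_num S u"
    using fin by (intro path_num_ge) auto
  moreover have "path_num ?T u \<le> deg ?T u"
    using fin cl u by (intro path_num_le_deg) auto
  moreover have "deg ?T u = length zs"
    unfolding deg_def using zs by (metis distinct_card)
  ultimately show ?thesis by simp
qed

section \<open>Longest paths and the cycles on their vertices\<close>

lemma neighbour_of_hd_in_longest_path:
  assumes "path_in S xs" and longest: "\<And>ys. path_in S ys \<Longrightarrow> length ys \<le> length xs"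
    and "u \<in> S" "R (hd xs) u"
  shows "u \<in> set xs"
proof (rule ccontr)
  assume "u \<notin> set xs"
  then have "path_in S (u # xs)" using assms sym by (intro path_in_Cons) auto
  then show False using longest by fastforce
qed

text \<open>By counting, \<open>hd xs\<close> is adjacent to the successor of some neighbour of \<open>last xs\<close>. This
  turns the path into a cycle, and any edge leaving the cycle yields a longer path.\<close>

lemma longest_path_closed:
  assumes fin: "finite S" and xs: "path_in S xs"
    and longest: "\<And>ys. path_in S ys \<Longrightarrow> length ys \<le> length xs"
    and d1: "length xs - 1 < 2 * deg S (hd xs)" and d2: "length xs - 1 < 2 * deg S (last xs)"
    and "x \<in> set xs" "y \<in> S" "R x y"
  shows "y \<in> set xs"
proof (rule ccontr)
  assume y: "y \<notin> set xs"
  define m where "m = length xs - 1"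
  have len: "length xs = Suc m" using xs by (auto simp: m_def path_in_def)
  have hd: "hd xs = xs ! 0" and last: "last xs = xs ! m"
    using xs by (auto simp: m_def path_in_def hd_conv_nth last_conv_nth)
  \<comment> \<open>\<open>A\<close> records predecessors of neighbours of \<open>hd xs\<close>, so
    that an index common to \<open>A\<close> and \<open>B\<close> singles out a path edge from
    \<open>xs ! i\<close> to \<open>xs ! Suc i\<close> that can be exchanged for two edges to the
    ends.\<close>
  define A where "A = {i. i < m \<and> R (hd xs) (xs ! Suc i)}"
  define B where "B = {i. i < m \<and> R (last xs) (xs ! i)}"
  have AB: "finite A" "finite B" "A \<union> B \<subseteq> {..<m}" by (auto simp: A_def B_def)
  have "{u \<in> S. R (hd xs) u} \<subseteq> (\<lambda>i. xs ! Suc i) ` A"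
  proof
    fix u assume u: "u \<in> {u \<in> S. R (hd xs) u}"
    then have "u \<in> set xs" using neighbour_of_hd_in_longest_path[OF xs longest] by auto
    then obtain j where j: "j < length xs" "u = xs ! j" by (auto simp: in_set_conv_nth)
    moreover have "j \<noteq> 0" using u j irrefl hd by (cases j) auto
    ultimately show "u \<in> (\<lambda>i. xs ! Suc i) ` A"
      using u len by (intro image_eqI[of _ _ "j - 1"]) (auto simp: A_def)
  qed
  then have dA: "deg S (hd xs) \<le> card A"
    unfolding deg_def by (rule surj_card_le[OF AB(1)])
  have "{u \<in> S. R (last xs) u} \<subseteq> (\<lambda>i. xs ! i) ` B"
  proof
    fix u assume u: "u \<in> {u \<in> S. R (last xs) u}"
    have "hd (rev xs) = last xs" using xs by (simp add: hd_rev path_in_def)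
    then have "u \<in> set xs"
      using neighbour_of_hd_in_longest_path[OF path_in_rev[OF xs], of u] longest u by auto
    then obtain j where j: "j < length xs" "u = xs ! j" by (auto simp: in_set_conv_nth)
    moreover have "j \<noteq> m" using u j irrefl last by auto
    ultimately show "u \<in> (\<lambda>i. xs ! i) ` B"
      using u len by (auto simp: B_def)
  qed
  then have dB: "deg S (last xs) \<le> card B"
    unfolding deg_def by (rule surj_card_le[OF AB(2)])
  \<comment> \<open>Both degrees exceed \<open>m / 2\<close>, so \<open>A\<close> and
    \<open>B\<close> cannot be disjoint among only \<open>m\<close> indices.\<close>
  have "A \<inter> B \<noteq> {}"
  proof
    assume "A \<inter> B = {}"
    then have "card A + card B = card (A \<union> B)" using AB by (simp add: card_Un_disjoint)
    also have "\<dots> \<le> m" using card_mono[OF _ AB(3)] by simp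
    finally show False using dA dB d1 d2 by (simp add: m_def)
  qed
  then obtain i where i: "i < m" "R (hd xs) (xs ! Suc i)" "R (last xs) (xs ! i)"
    by (auto simp: A_def B_def)
  define P where "P = take (Suc i) xs"
  define Q where "Q = drop (Suc i) xs"
  have PQ: "xs = P @ Q" "P \<noteq> []" "Q \<noteq> []" using i len by (auto simp: P_def Q_def)
  have ends: "hd P = hd xs" "last Q = last xs"
    using PQ(2,3) by (simp_all add: PQ(1))
  have next_ends: "hd Q = xs ! Suc i" "last P = xs ! i"
    using i(1) len by (simp_all add: P_def Q_def hd_drop_conv_nth take_Suc_conv_app_nth)
  have links: "R (last P) (last Q)" "R (hd Q) (hd P)"
    unfolding ends next_ends using i(2,3) by (blast intro: sym)+
  \<comment> \<open>Traverse \<open>P\<close>, jump from its end to the end of \<open>Q\<close>, and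
    return through \<open>Q\<close> to \<open>hd Q\<close>, which is adjacent to
    \<open>hd P\<close>.\<close>
  define C where "C = P @ rev Q"
  have C: "path_in S C" "set C = set xs" "length C = length xs"
    using xs PQ(2,3) links(1) unfolding PQ(1)
    by (auto simp: C_def path_in_def successively_append_iff hd_rev successively_rev_iff
        simp del: successively_rev)
  have closing: "R (last C) (hd C)"
    using links(2) PQ(2,3) by (simp add: C_def last_rev)
  obtain as bs where split: "C = as @ x # bs"
    using \<open>x \<in> set xs\<close> C(2) split_list by metis
  \<comment> \<open>The cycle is cut open so that it starts at \<open>x\<close>; then
    \<open>y\<close> fits in front.\<close>
  have "path_in S (x # bs @ as)"
    using C(1) closing unfolding split
    by (cases "as = []"; cases "bs = []")
      (auto simp: path_in_def successively_append_iff successively_Cons)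
  then have "path_in S (y # x # bs @ as)"
  proof (rule path_in_Cons)
    show "y \<notin> set (x # bs @ as)" using y C(2) unfolding split by auto
  qed (use \<open>y \<in> S\<close> sym[OF \<open>R x y\<close>] in simp_all)
  then have "length (y # x # bs @ as) \<le> length xs" by (rule longest)
  then show False using C(3) unfolding split by simp
qed

section \<open>The inequality for degree sums and its equality case\<close>

text \<open>Deleting \<open>v\<close> loses its own degree and one unit at each of its
  neighbours.\<close>

lemma sum_deg_delete:
  assumes "finite S" "v \<in> S"
  shows "(\<Sum>u\<in>S. deg S u) = (\<Sum>u\<in>S - {v}. deg (S - {v}) u) + 2 * deg S v"
proof -
  let ?T = "S - {v}"
  have "deg S u = deg ?T u + (if R v u then 1 else 0)" for u
  proof (cases "R v u")
    case True
    then have "{w \<in> S. R u w} = insert v {w \<in> ?T. R u w}" using assms sym by auto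
    then show ?thesis using assms True by (simp add: deg_def)
  next
    case False
    then have "{w \<in> S. R u w} = {w \<in> ?T. R u w}" using sym by auto
    then show ?thesis using False by (simp add: deg_def)
  qed
  then have "(\<Sum>u\<in>?T. deg S u) = (\<Sum>u\<in>?T. deg ?T u) + (\<Sum>u\<in>?T. if R v u then 1 else 0)"
    by (simp add: sum.distrib)
  also have "(\<Sum>u\<in>?T. if R v u then 1 else 0) = card {u \<in> ?T. R v u}"
    using assms by (simp add: sum.If_cases Int_def)
  also have "{u \<in> ?T. R v u} = {u \<in> S. R v u}" using irrefl by auto
  finally show ?thesis using assms by (simp add: sum.remove[of S v] deg_def)
qed

text \<open>The degree sum stands for twice the number of edges. Both claims share one induction,
  since equality for \<open>S\<close> passes to the smaller set, and the cluster property obtained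
  there is used for \<open>S\<close>.\<close>

lemma sum_deg_le_sum_path_num:
  assumes "finite S"
  shows "(\<Sum>v\<in>S. deg S v) \<le> (\<Sum>v\<in>S. path_num S v) \<and>
    ((\<Sum>v\<in>S. deg S v) = (\<Sum>v\<in>S. path_num S v) \<longrightarrow> cluster S)"
  using assms
proof (induction S rule: finite_psubset_induct)
  case (psubset S)
  note fin = \<open>finite S\<close>
  show ?case
  proof (cases "S = {}")
    case False
    then obtain s where "path_in S [s]" using path_in_singleton by auto
    then obtain xs where xs: "path_in S xs" and longest: "\<And>ys. path_in S ys \<Longrightarrow> length ys \<le> length xs"
      using ex_has_greatest_nat[of "path_in S" "[s]" length "Suc (card S)"] length_path_in[OF fin]
      by (metis le_imp_less_Suc)
    define k where "k = length xs - 1"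
    have sub: "set xs \<subseteq> S" "xs \<noteq> []" using xs by (auto simp: path_in_def)
    have pk: "path_num S v = k" if v: "v \<in> set xs" for v
    proof (rule antisym)
      obtain ys where "path_in S ys" "path_num S v = length ys - 1"
        using path_num_attained[OF fin, of v] v sub by blast
      then show "path_num S v \<le> k" using longest[of ys] by (simp add: k_def)
      show "k \<le> path_num S v" using path_num_ge[OF fin xs v] by (simp add: k_def)
    qed
    show ?thesis
    proof (cases "\<exists>v\<in>set xs. 2 * deg S v \<le> k")
      case True
      then obtain v where v: "v \<in> set xs" "2 * deg S v \<le> k" by auto
      let ?T = "S - {v}"
      have vS: "v \<in> S" using v sub by auto
      then have "?T \<subset> S" by auto
      note IH = psubset.IH[OF this]
      have mono: "path_num ?T u \<le> path_num S u" if "u \<in> ?T" for u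
        using that fin by (intro path_num_mono) auto
      have sumT: "(\<Sum>u\<in>?T. path_num ?T u) \<le> (\<Sum>u\<in>?T. path_num S u)"
        using mono by (rule sum_mono)
      have sumS: "(\<Sum>u\<in>S. path_num S u) = k + (\<Sum>u\<in>?T. path_num S u)"
        using sum.remove[OF fin vS, of "path_num S"] pk[OF v(1)] by simp
      \<comment> \<open>Deleting \<open>v\<close> costs \<open>2 * deg S v\<close> on the left, at
        most the \<open>k\<close> that \<open>v\<close> contributes on the right, and the other path
        numbers cannot grow.\<close>
      have le: "(\<Sum>v\<in>S. deg S v) \<le> (\<Sum>v\<in>S. path_num S v)"
        using IH sumT sumS v(2) sum_deg_delete[OF fin vS] by simp
      moreover have "cluster S" if eq: "(\<Sum>v\<in>S. deg S v) = (\<Sum>v\<in>S. path_num S v)"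
      proof -
        \<comment> \<open>Equality for \<open>S\<close> makes every estimate in the chain sharp, so
          it holds for \<open>?T\<close> as well and no path number drops there.\<close>
        have eqT: "(\<Sum>u\<in>?T. path_num ?T u) = (\<Sum>u\<in>?T. path_num S u)"
          and cl: "cluster ?T"
          using eq IH sumT sumS v(2) sum_deg_delete[OF fin vS] by auto
        have "\<not> R v u" if u: "u \<in> S" for u
        proof
          assume "R v u"
          then have "path_num ?T u < path_num S u"
            using path_num_less_of_neighbour[OF fin cl vS u] by simp
          moreover have "u \<in> ?T" using u \<open>R v u\<close> irrefl by auto
          ultimately have "(\<Sum>u\<in>?T. path_num ?T u) < (\<Sum>u\<in>?T. path_num S u)"
            using mono fin by (intro sum_strict_mono_ex1) auto
          with eqT show False by simp
        qed
        then have isolated: "x \<noteq> v" "y \<noteq> v" if "x \<in> S" "y \<in> S" "R x y" for x y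
          using that sym by blast+
        show ?thesis
          unfolding cluster_def
        proof (intro ballI impI)
          fix x y z assume *: "x \<in> S" "y \<in> S" "z \<in> S" "R x y" "R y z"
          then have "x \<in> ?T" "y \<in> ?T" "z \<in> ?T" using isolated by blast+
          then show "x = z \<or> R x z" using cl * unfolding cluster_def by blast
        qed
      qed
      ultimately show ?thesis by blast
    next
      case False
      define X where "X = set xs"
      \<comment> \<open>In this case every vertex of the path, in particular each end, has degree
        above \<open>k / 2\<close>, so \<open>longest_path_closed\<close> applies.\<close>
      have closed: "y \<in> X" if "x \<in> X" "y \<in> S" "R x y" for x y
        using longest_path_closed[OF fin xs longest, of x y] that False sub(2)
        by (auto simp: X_def k_def not_le)
      let ?T = "S - X"
      have X: "X \<subseteq> S" "finite X" "X \<noteq> {}" "card X = Suc k"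
        using sub xs by (auto simp: X_def k_def path_in_def distinct_card)
      then have "?T \<subset> S" by blast
      note IH = psubset.IH[OF this]
      have degT: "deg S u = deg ?T u" if "u \<in> ?T" for u
      proof -
        have "{w \<in> S. R u w} = {w \<in> ?T. R u w}" using that closed sym by blast
        then show ?thesis by (simp add: deg_def)
      qed
      have nbh: "{w \<in> S. R u w} \<subseteq> X - {u}" if "u \<in> X" for u
        using that closed irrefl by auto
      have degX: "deg S u \<le> k" if "u \<in> X" for u
        using card_mono[OF _ nbh[OF that]] X that by (simp add: deg_def)
      have sumdX: "(\<Sum>u\<in>X. deg S u) \<le> (\<Sum>u\<in>X. path_num S u)"
        using degX pk by (intro sum_mono) (auto simp: X_def)
      have sumpT: "(\<Sum>u\<in>?T. path_num ?T u) \<le> (\<Sum>u\<in>?T. path_num S u)"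
        using fin by (intro sum_mono path_num_mono) auto
      have sums: "(\<Sum>u\<in>S. deg S u) = (\<Sum>u\<in>?T. deg ?T u) + (\<Sum>u\<in>X. deg S u)"
        "(\<Sum>u\<in>S. path_num S u) = (\<Sum>u\<in>?T. path_num S u) + (\<Sum>u\<in>X. path_num S u)"
        using sum.subset_diff[OF X(1) fin, of "deg S"]
          sum.subset_diff[OF X(1) fin, of "path_num S"] sum.cong[OF refl degT, of ?T]
        by simp_all
      have "cluster S" if eq: "(\<Sum>v\<in>S. deg S v) = (\<Sum>v\<in>S. path_num S v)"
      proof -
        have eqX: "(\<Sum>u\<in>X. deg S u) = (\<Sum>u\<in>X. path_num S u)" and cl: "cluster ?T"
          using eq IH sumpT sumdX sums by auto
        \<comment> \<open>No degree in \<open>X\<close> exceeds \<open>k\<close> and the sums agree,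
          so each vertex of \<open>X\<close> has degree \<open>k\<close> and is adjacent to all
          \<open>k\<close> others.\<close>
        have clique: "R x y" if "x \<in> X" "y \<in> X" "x \<noteq> y" for x y
        proof -
          have "deg S x = k"
          proof (rule ccontr)
            assume "deg S x \<noteq> k"
            then have "deg S x < path_num S x" using degX[OF that(1)] pk that by (auto simp: X_def)
            then have "(\<Sum>u\<in>X. deg S u) < (\<Sum>u\<in>X. path_num S u)"
              using degX pk that X(2) by (intro sum_strict_mono_ex1) (auto simp: X_def)
            with eqX show False by simp
          qed
          then have "{w \<in> S. R x w} = X - {x}"
            using X that nbh by (intro card_subset_eq) (auto simp: deg_def)
          then show ?thesis using that by blast
        qed
        show ?thesis
          unfolding cluster_def
        proof (intro ballI impI)
          fix x y z assume *: "x \<in> S" "y \<in> S" "z \<in> S" "R x y" "R y z"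
          \<comment> \<open>No edge joins \<open>X\<close> to \<open>?T\<close>, so
            \<open>x\<close>, \<open>y\<close> and \<open>z\<close> lie on the same side.\<close>
          show "x = z \<or> R x z"
          proof (cases "y \<in> X")
            case True
            then have "x \<in> X" "z \<in> X" using * closed sym by blast+
            then show ?thesis using clique by blast
          next
            case False
            then have "x \<in> ?T" "y \<in> ?T" "z \<in> ?T" using * closed sym by blast+
            then show ?thesis using cl * unfolding cluster_def by blast
          qed
        qed
      qed
      then show ?thesis using IH sumdX sumpT sums by auto
    qed
  qed (simp add: cluster_def)
qed

text \<open>For a cluster, summing \<open>path_num_le_deg\<close> gives the reverse
  inequality.\<close>

lemma sum_deg_eq_iff_cluster:
  assumes "finite S"
  shows "(\<Sum>v\<in>S. deg S v) = (\<Sum>v\<in>S. path_num S v) \<longleftrightarrow> cluster S"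
  using sum_deg_le_sum_path_num[OF assms] sum_mono[OF path_num_le_deg[OF assms], of S]
  by (meson le_antisym)

end

section \<open>Edges and connected components of a graph\<close>

lemma set_vwalk_arcs_subset_iff: "set (vwalk_arcs xs) \<subseteq> E \<longleftrightarrow> successively (\<lambda>x y. (x, y) \<in> E) xs"
  by (induction xs rule: vwalk_arcs.induct) auto

context graph
begin

lemma edges_conv: "edges G = (\<lambda>(x, y). {x, y}) ` arcs_ends G"
  by (auto simp: edges_def arcs_ends_conv)

text \<open>Forgetting the orientation is two-to-one, because arcs come in opposite pairs and there
  are no loops.\<close>

lemma card_arcs_ends: "card (arcs_ends G) = 2 * card (edges G)"
proof -
  let ?f = "\<lambda>(x, y). {x, y}"
  have fin: "finite (arcs_ends G)" by (simp add: arcs_ends_def)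
  have "card {p \<in> arcs_ends G. ?f p = e} = 2" if "e \<in> edges G" for e
  proof -
    obtain x y where xy: "e = {x, y}" "(x, y) \<in> arcs_ends G"
      using \<open>e \<in> edges G\<close> by (auto simp: edges_conv)
    then have "{p \<in> arcs_ends G. ?f p = e} = {(x, y), (y, x)}" and "x \<noteq> y"
      using graph_symmetric adj_not_same by (auto simp: doubleton_eq_iff)
    then show ?thesis by simp
  qed
  moreover have "card (arcs_ends G) = (\<Sum>e\<in>?f ` arcs_ends G. card {p \<in> arcs_ends G. ?f p = e})"
    using sum.image_gen[OF fin, of "\<lambda>_. 1::nat" ?f] by simp
  ultimately show ?thesis by (simp add: edges_conv)
qed

text \<open>\<open>connected\<close> refers to the symmetric closure, and for a symmetric graph this
  closure has the same reachability.\<close>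

lemma connected_subgraph_reachable:
  assumes "subgraph H G" "Digraph_Component.connected H" "u \<in> verts H" "v \<in> verts H"
  shows "u \<rightarrow>\<^sup>* v"
proof -
  have "u \<rightarrow>\<^sup>*\<^bsub>mk_symmetric H\<^esub> v"
    using assms by (auto simp: connected_def)
  then have "u \<rightarrow>\<^sup>*\<^bsub>mk_symmetric G\<^esub> v"
    using subgraph_mk_symmetric[OF assms(1)] by (rule pre_digraph.reachable_mono)
  then show ?thesis using reachable_mk_symmetric_eq[OF sym_arcs] by simp
qed

text \<open>Supplies the component of a given vertex. A connected \<open>H\<close> containing it
  cannot extend beyond the vertices reachable from \<open>u\<close>, and the induced subgraph
  already has all arcs among these.\<close>

lemma induce_reachable_in_components:
  assumes "u \<in> verts G"
  shows "G \<restriction> {v. u \<rightarrow>\<^sup>* v} \<in> components G"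
proof -
  let ?C = "G \<restriction> {v. u \<rightarrow>\<^sup>* v}"
  have C: "induced_subgraph ?C G" "strongly_connected ?C"
    using induce_reachable_is_in_sccs[OF assms] by (auto simp: sccs_def)
  have "max_subgraph Digraph_Component.connected ?C"
  proof (rule max_subgraphI)
    interpret C: wf_digraph ?C using C(1) by (rule wf_digraphI_induced)
    show "Digraph_Component.connected ?C"
      using C(2) C.reachable_mk_symmetricI by (auto simp: connected_def strongly_connected_def)
    show "subgraph ?C G" using C(1) by (rule induced_imp_subgraph)
    fix H assume H: "?C \<noteq> H" "subgraph ?C H" "subgraph H G"
    show "\<not> Digraph_Component.connected H"
    proof
      assume "Digraph_Component.connected H"
      moreover have "u \<in> verts H" using H(2) assms by (auto simp: subgraph_def)
      ultimately have "verts H \<subseteq> {v. u \<rightarrow>\<^sup>* v}"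
        using connected_subgraph_reachable[OF H(3)] by auto
      then have "verts H = verts ?C" using H(2) by (auto simp: subgraph_def)
      moreover have "arcs H = arcs ?C"
        using C(1) H(2,3) \<open>verts H = verts ?C\<close>
        unfolding induced_subgraph_altdef by blast
      ultimately show False using H(1,2) by (auto simp: subgraph_def compatible_def)
    qed
  qed
  then show ?thesis by (simp add: components_def)
qed

text \<open>The reason why components are induced: a missing arc between vertices of a connected
  subgraph could be added without losing connectedness.\<close>

lemma arc_mono_connected: "arc_mono Digraph_Component.connected"
  unfolding arc_mono_def
  by (metis spanning_def subgraphE wf_digraph.connected_spanning_imp_connected)

lemma component_induced: "C \<in> components G \<Longrightarrow> induced_subgraph C G"
  using induced_subgraphI_arc_mono arc_mono_connected by (auto simp: components_def)

section \<open>Translation of the degree sum result to graphs\<close>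

interpretation adj: simple_adjacency "\<lambda>x y. (x, y) \<in> arcs_ends G"
  using graph_symmetric adj_not_same by unfold_locales auto

lemma vpath_iff_path_in: "vpath xs G \<longleftrightarrow> adj.path_in (verts G) xs"
  by (auto simp: vpath_def vwalk_def adj.path_in_def set_vwalk_arcs_subset_iff)

lemma path_number_eq: "path_number G v = adj.path_num (verts G) v"
  by (simp add: path_number_def adj.path_num_def vpath_iff_path_in)

text \<open>The handshake identity: the pairs of a vertex and one of its neighbours are the members
  of \<open>arcs_ends G\<close>.\<close>

lemma sum_deg: "(\<Sum>v\<in>verts G. adj.deg (verts G) v) = 2 * card (edges G)"
proof -
  have "(\<Sum>v\<in>verts G. adj.deg (verts G) v) =
      card (SIGMA v:verts G. {u \<in> verts G. (v, u) \<in> arcs_ends G})"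
    by (simp add: adj.deg_def)
  also have "(SIGMA v:verts G. {u \<in> verts G. (v, u) \<in> arcs_ends G}) = arcs_ends G"
    using adj_in_verts by auto
  finally show ?thesis by (simp add: card_arcs_ends)
qed

text \<open>Without an induced path on three vertices, adjacency to \<open>u\<close> propagates
  along walks from \<open>u\<close>, so components are complete. Conversely, \<open>x\<close>,
  \<open>y\<close> and \<open>z\<close> all lie in the component of \<open>x\<close>, where distinct
  vertices are adjacent.\<close>

lemma cluster_iff_components: "adj.cluster (verts G) \<longleftrightarrow> (\<forall>C\<in>components G. is_clique C)"
proof
  assume cl: "adj.cluster (verts G)"
  show "\<forall>C\<in>components G. is_clique C"
  proof
    fix C assume C: "C \<in> components G"
    then have ind: "induced_subgraph C G" by (rule component_induced)
    then have sub: "subgraph C G" by (rule induced_imp_subgraph)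
    interpret C: digraph C using ind by (rule digraphI_induced)
    have "symmetric C" using sym_arcs ind by (rule induced_graph_imp_symmetric)
    then have graphC: "graph C" by (rule C.graphI)
    have conn: "Digraph_Component.connected C"
      using C by (auto simp: components_def max_subgraph_def)
    have near: "u = v \<or> (u, v) \<in> arcs_ends G" if "u \<rightarrow>\<^sup>* v" for u v
      using that
    proof (induction rule: reachable_induct)
      case (step x y)
      then have "u \<in> verts G" "x \<in> verts G" "y \<in> verts G"
        by (auto dest: reachable_in_verts adj_in_verts)
      then show ?case using step.IH step.hyps(2) cl unfolding adj.cluster_def by blast
    qed simp
    \<comment> \<open>Adjacency found in \<open>G\<close> has to be brought back into
      \<open>C\<close>, which works as \<open>C\<close> is induced.\<close>
    have ends: "(u, v) \<in> arcs_ends C"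
      if uv: "(u, v) \<in> arcs_ends G" "u \<in> verts C" "v \<in> verts C" for u v
    proof -
      obtain a where "a \<in> arcs G" "tail G a = u" "head G a = v"
        using uv(1) by (auto simp: arcs_ends_conv)
      moreover have "tail C = tail G" "head C = head G"
        using sub by (simp_all add: subgraph_def compatible_def)
      moreover have "arcs C = {e \<in> arcs G. tail G e \<in> verts C \<and> head G e \<in> verts C}"
        using ind by auto
      ultimately have "a \<in> arcs C" "arc_to_ends C a = (u, v)"
        using uv(2,3) by (simp_all add: arc_to_ends_def)
      then show ?thesis using C.dominatesI by blast
    qed
    have "(u, v) \<in> arcs_ends C \<longleftrightarrow> u \<in> verts C \<and> v \<in> verts C \<and> u \<noteq> v" for u v
      using near connected_subgraph_reachable[OF sub conn] ends C.adj_in_verts C.adj_not_same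
      by metis
    then have "arcs_ends C = {(u, v). (u, v) \<in> verts C \<times> verts C \<and> u \<noteq> v}" by auto
    then show "is_clique C" using graphC by (auto simp: is_clique_def complete_digraph_def)
  qed
next
  assume cliques: "\<forall>C\<in>components G. is_clique C"
  show "adj.cluster (verts G)"
    unfolding adj.cluster_def
  proof (intro ballI impI)
    fix x y z
    assume *: "x \<in> verts G" "(x, y) \<in> arcs_ends G" "(y, z) \<in> arcs_ends G"
    let ?C = "G \<restriction> {v. x \<rightarrow>\<^sup>* v}"
    have "?C \<in> components G" using *(1) by (rule induce_reachable_in_components)
    then have "is_clique ?C" "subgraph ?C G"
      using cliques component_induced induced_imp_subgraph by blast+
    moreover have "x \<rightarrow>\<^sup>* x" "x \<rightarrow>\<^sup>* z"
      using * by (auto intro: reachable_adj_trans)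
    ultimately show "x = z \<or> (x, z) \<in> arcs_ends G"
      using arcs_ends_mono[of ?C G] by (auto simp: is_clique_def complete_digraph_def)
  qed
qed

lemma two_card_edges_le_sum_path_number: "2 * card (edges G) \<le> (\<Sum>v\<in>verts G. path_number G v)"
  using adj.sum_deg_le_sum_path_num[OF finite_verts] by (simp add: sum_deg path_number_eq)

lemma two_card_edges_eq_iff:
  "2 * card (edges G) = (\<Sum>v\<in>verts G. path_number G v) \<longleftrightarrow> (\<forall>C\<in>components G. is_clique C)"
  using adj.sum_deg_eq_iff_cluster[OF finite_verts]
  by (simp add: sum_deg path_number_eq cluster_iff_components)

end

theorem theorem2p1:
  fixes G :: "('a, 'b) pre_digraph"
  assumes "graph G"
  shows "real (card (edges G)) \<le> (\<Sum>v\<in>verts G. real (path_number G v) / 2)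
    \<and> (real (card (edges G)) = (\<Sum>v\<in>verts G. real (path_number G v) / 2)
        \<longleftrightarrow> (\<forall>C\<in>components G. is_clique C))"
proof -
  interpret graph G by fact
  \<comment> \<open>The factor one half is pulled out so that the doubled statements over the
    naturals apply.\<close>
  have "(\<Sum>v\<in>verts G. real (path_number G v) / 2) = real (\<Sum>v\<in>verts G. path_number G v) / 2"
    by (simp add: sum_divide_distrib)
  then show ?thesis
    using two_card_edges_le_sum_path_number two_card_edges_eq_iff by linarith
qed

end
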